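(* For symplectic GARK schemes with $N$ partitions the number of order conditions is reduced due to redundancy, in the following sense. (Order 2) Of the $N^2$ order-2 conditions one can select $N(N-1)/2$ conditions such that every symplectic GARK scheme of order at least 1 that satisfies the selected conditions satisfies all order-2 conditions. (Order 3) Of the $(3N^3+N^2)/2$ order-3 conditions one can select $(N^3+N^2)/2$ conditions such that every symplectic GARK scheme of order at least 2 that satisfies the selected conditions satisfies all order-3 conditions. (Order 4) Of the $(8N^4+3N^3+N^2)/3$ order-4 conditions one can select $(4N^4+3N^3-N^2)/6$ conditions such that every symplectic GARK scheme of order at least 3 that satisfies the selected conditions satisfies all order-4 conditions.
   Context: A GARK scheme with $N$ partitions is given by real coefficients $\mathbf A^{\{q,m\}}\in\mathbb R^{s^{\{q\}}\times s^{\{m\}}}$, $\mathbf b^{\{m\}}\in\mathbb R^{s^{\{m\}}}$, $q,m=1,\dots,N$. Put $\mathbf 1^{\{m\}}=(1,\dots,1)^\top\in\mathbb R^{s^{\{m\}}}$, $\mathbf c^{\{q,m\}}=\mathbf A^{\{q,m\}}\mathbf 1^{\{m\}}$, $\mathbf B^{\{m\}}=\operatorname{diag}(\mathbf b^{\{m\}})$; $\times$ denotes the component-wise product of vectors. The scheme is symplectic if $$(\mathbf A^{\{\ell,m\}})^{\top}\mathbf B^{\{\ell\}}+\mathbf B^{\{m\}}\mathbf A^{\{m,\ell\}}=\mathbf b^{\{m\}}(\mathbf b^{\{\ell\}})^{\top}\quad\text{for all }\ell,m=1,\dots,N.$$ The order conditions (all indices $m,\ell,s,t$ range over $\{1,\dots,N\}$)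 are: Order 1: $\mathbf b^{\{m\}\top}\mathbf 1^{\{m\}}=1$ for all $m$. Order 2: $\mathbf b^{\{m\}\top}\mathbf c^{\{m,\ell\}}=\tfrac12$ for all $m,\ell$. Order 3: (3a) $\mathbf b^{\{m\}\top}(\mathbf c^{\{m,\ell\}}\times\mathbf c^{\{m,s\}})=\tfrac13$ for all $m$ and all $\ell\le s$; (3b) $\mathbf b^{\{m\}\top}\mathbf A^{\{m,\ell\}}\mathbf c^{\{\ell,s\}}=\tfrac16$ for all $m,\ell,s$. Order 4: (4a) $\mathbf b^{\{m\}\top}(\mathbf c^{\{m,\ell\}}\times\mathbf c^{\{m,s\}}\times\mathbf c^{\{m,t\}})=\tfrac14$ for all $m$ and all $\ell\le s\le t$; (4b) $\mathbf b^{\{m\}\top}(\mathbf c^{\{m,\ell\}}\times\mathbf A^{\{m,s\}}\mathbf c^{\{s,t\}})=\tfrac18$ for all $m,\ell,s,t$; (4c) $\mathbf b^{\{m\}\top}\mathbf A^{\{m,\ell\}}(\mathbf c^{\{\ell,s\}}\times\mathbf c^{\{\ell,t\}})=\tfrac1{12}$ for all $m,\ell$ and all $s\le t$; (4d) $\mathbf b^{\{m\}\top}\mathbf A^{\{m,\ell\}}\mathbf A^{\{\ell,s\}}\mathbf c^{\{s,t\}}=\tfrac1{24}$ for all $m,\ell,s,t$. Conditions are counted with one condition per admissible index tuple. A scheme has order at least $k$ ($k\le 4$) if it satisfies all the conditions of orders $1,\dots,k$. The selection of conditions (i.e. of index tuples) depends only on $N$, not on the scheme. *)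

theory Defs
  imports Complex_Main "Jordan_Normal_Form.Matrix"
begin

text \<open>
  Partitions are numbered \<open>1..N\<close>; the values of the fields outside this range are irrelevant.
  The stages of partition \<open>m\<close> are numbered \<open>0..<stages G m\<close>, the convention of the vector library.
\<close>

record gark =
  stages :: "nat \<Rightarrow> nat"
  Acoeff :: "nat \<Rightarrow> nat \<Rightarrow> real mat"
  bcoeff :: "nat \<Rightarrow> real vec"

definition gark_scheme :: "nat \<Rightarrow> gark \<Rightarrow> bool" where
  "gark_scheme N G \<longleftrightarrow>
     (\<forall>q\<in>{1..N}. \<forall>m\<in>{1..N}. Acoeff G q m \<in> carrier_mat (stages G q) (stages G m)) \<and>
     (\<forall>m\<in>{1..N}. bcoeff G m \<in> carrier_vec (stages G m))"

definition ones :: "gark \<Rightarrow> nat \<Rightarrow> real vec" where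
  "ones G m = vec (stages G m) (\<lambda>_. 1)"

definition ccoeff :: "gark \<Rightarrow> nat \<Rightarrow> nat \<Rightarrow> real vec" where
  "ccoeff G q m = Acoeff G q m *\<^sub>v ones G m"

definition Bdiag :: "gark \<Rightarrow> nat \<Rightarrow> real mat" where
  "Bdiag G m = mat_diag (stages G m) (\<lambda>i. bcoeff G m $ i)"

definition cprod :: "real vec \<Rightarrow> real vec \<Rightarrow> real vec" (infixl \<open>\<odot>\<close> 70) where
  "u \<odot> v = vec (dim_vec u) (\<lambda>i. u $ i * v $ i)"

definition outer :: "real vec \<Rightarrow> real vec \<Rightarrow> real mat" where
  "outer u v = mat (dim_vec u) (dim_vec v) (\<lambda>(i, j). u $ i * v $ j)"

definition symplectic :: "nat \<Rightarrow> gark \<Rightarrow> bool" where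
  "symplectic N G \<longleftrightarrow>
     (\<forall>l\<in>{1..N}. \<forall>m\<in>{1..N}.
        transpose_mat (Acoeff G l m) * Bdiag G l + Bdiag G m * Acoeff G m l
          = outer (bcoeff G m) (bcoeff G l))"

text \<open>
  An order condition is represented by its family together with its index tuple, so that
  conditions are counted with one condition per admissible tuple and a selection of conditions
  makes no reference to a scheme.
\<close>

datatype order_cond =
    Cond1 nat
  | Cond2 nat nat
  | Cond3a nat nat nat
  | Cond3b nat nat nat
  | Cond4a nat nat nat nat
  | Cond4b nat nat nat nat
  | Cond4c nat nat nat nat
  | Cond4d nat nat nat nat

primrec satisfies :: "gark \<Rightarrow> order_cond \<Rightarrow> bool" where
  "satisfies G (Cond1 m) \<longleftrightarrow>
     bcoeff G m \<bullet> ones G m = 1"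
| "satisfies G (Cond2 m l) \<longleftrightarrow>
     bcoeff G m \<bullet> ccoeff G m l = 1 / 2"
| "satisfies G (Cond3a m l s) \<longleftrightarrow>
     bcoeff G m \<bullet> (ccoeff G m l \<odot> ccoeff G m s) = 1 / 3"
| "satisfies G (Cond3b m l s) \<longleftrightarrow>
     bcoeff G m \<bullet> (Acoeff G m l *\<^sub>v ccoeff G l s) = 1 / 6"
| "satisfies G (Cond4a m l s t) \<longleftrightarrow>
     bcoeff G m \<bullet> (ccoeff G m l \<odot> ccoeff G m s \<odot> ccoeff G m t) = 1 / 4"
| "satisfies G (Cond4b m l s t) \<longleftrightarrow>
     bcoeff G m \<bullet> (ccoeff G m l \<odot> (Acoeff G m s *\<^sub>v ccoeff G s t)) = 1 / 8"
| "satisfies G (Cond4c m l s t) \<longleftrightarrow>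
     bcoeff G m \<bullet> (Acoeff G m l *\<^sub>v (ccoeff G l s \<odot> ccoeff G l t)) = 1 / 12"
| "satisfies G (Cond4d m l s t) \<longleftrightarrow>
     bcoeff G m \<bullet> (Acoeff G m l *\<^sub>v (Acoeff G l s *\<^sub>v ccoeff G s t)) = 1 / 24"

definition order1_conds :: "nat \<Rightarrow> order_cond set" where
  "order1_conds N = {Cond1 m | m. m \<in> {1..N}}"

definition order2_conds :: "nat \<Rightarrow> order_cond set" where
  "order2_conds N = {Cond2 m l | m l. m \<in> {1..N} \<and> l \<in> {1..N}}"

definition order3_conds :: "nat \<Rightarrow> order_cond set" where
  "order3_conds N =
     {Cond3a m l s | m l s. m \<in> {1..N} \<and> l \<in> {1..N} \<and> s \<in> {1..N} \<and> l \<le> s} \<union>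
     {Cond3b m l s | m l s. m \<in> {1..N} \<and> l \<in> {1..N} \<and> s \<in> {1..N}}"

definition order4_conds :: "nat \<Rightarrow> order_cond set" where
  "order4_conds N =
     {Cond4a m l s t | m l s t.
        m \<in> {1..N} \<and> l \<in> {1..N} \<and> s \<in> {1..N} \<and> t \<in> {1..N} \<and> l \<le> s \<and> s \<le> t} \<union>
     {Cond4b m l s t | m l s t. m \<in> {1..N} \<and> l \<in> {1..N} \<and> s \<in> {1..N} \<and> t \<in> {1..N}} \<union>
     {Cond4c m l s t | m l s t.
        m \<in> {1..N} \<and> l \<in> {1..N} \<and> s \<in> {1..N} \<and> t \<in> {1..N} \<and> s \<le> t} \<union>
     {Cond4d m l s t | m l s t. m \<in> {1..N} \<and> l \<in> {1..N} \<and> s \<in> {1..N} \<and> t \<in> {1..N}}"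

definition satisfies_all :: "gark \<Rightarrow> order_cond set \<Rightarrow> bool" where
  "satisfies_all G S \<longleftrightarrow> (\<forall>c\<in>S. satisfies G c)"

definition order_at_least_1 :: "nat \<Rightarrow> gark \<Rightarrow> bool" where
  "order_at_least_1 N G \<longleftrightarrow> satisfies_all G (order1_conds N)"

definition order_at_least_2 :: "nat \<Rightarrow> gark \<Rightarrow> bool" where
  "order_at_least_2 N G \<longleftrightarrow> order_at_least_1 N G \<and> satisfies_all G (order2_conds N)"

definition order_at_least_3 :: "nat \<Rightarrow> gark \<Rightarrow> bool" where
  "order_at_least_3 N G \<longleftrightarrow> order_at_least_2 N G \<and> satisfies_all G (order3_conds N)"

end

theory Submission
  imports Defs
begin

text \<open>
  Read as a bilinear form, symplecticity says
  \<open>b\<^sub>m \<bullet> (u \<odot> A\<^sub>m\<^sub>l v) + b\<^sub>l \<bullet> (v \<odot> A\<^sub>l\<^sub>m u) = (b\<^sub>m \<bullet> u) (b\<^sub>l \<bullet> v)\<close> for all stage vectors \<open>u\<close>, \<open>v\<close>: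
  moving the root of a coloured tree across an edge relates the order conditions of the two rooted
  trees through conditions of lower order. Every (3b) condition is thereby equivalent to a (3a)
  condition, every (4c) to a (4a), every (4d) to a (4b), while the order-2 conditions and the (4b)
  conditions are exchanged among themselves by an involution. On a fixed point of the involution the
  condition holds automatically, and from each 2-cycle one representative suffices.
\<close>

section \<open>Algebra of the component-wise product\<close>

lemma cprod_carrier [simp]: "u \<in> carrier_vec n \<Longrightarrow> u \<odot> v \<in> carrier_vec n"
  by (simp add: cprod_def)

lemma cprod_commute: "u \<in> carrier_vec n \<Longrightarrow> v \<in> carrier_vec n \<Longrightarrow> u \<odot> v = v \<odot> u"
  by (auto simp: cprod_def)

lemma cprod_assoc: "u \<in> carrier_vec n \<Longrightarrow> v \<in> carrier_vec n \<Longrightarrow> (u \<odot> v) \<odot> w = u \<odot> (v \<odot> w)"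
  by (auto simp: cprod_def)

lemma cprod_left_commute:
  "u \<in> carrier_vec n \<Longrightarrow> v \<in> carrier_vec n \<Longrightarrow> w \<in> carrier_vec n \<Longrightarrow> u \<odot> (v \<odot> w) = v \<odot> (u \<odot> w)"
  by (auto simp: cprod_def)

lemma ones_carrier [simp]: "ones G m \<in> carrier_vec (stages G m)"
  by (simp add: ones_def)

lemma cprod_ones_left [simp]: "v \<in> carrier_vec (stages G m) \<Longrightarrow> ones G m \<odot> v = v"
  by (auto simp: cprod_def ones_def)

section \<open>Symplecticity as a bilinear identity\<close>

locale symplectic_gark =
  fixes N :: nat and G :: gark
  assumes scheme: "gark_scheme N G" and symplectic: "symplectic N G"
begin

abbreviation "P \<equiv> {1..N}"

lemma A_carrier [simp]:
  "q \<in> P \<Longrightarrow> m \<in> P \<Longrightarrow> Acoeff G q m \<in> carrier_mat (stages G q) (stages G m)"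
  using scheme by (simp add: gark_scheme_def)

lemma b_carrier [simp]: "m \<in> P \<Longrightarrow> bcoeff G m \<in> carrier_vec (stages G m)"
  using scheme by (simp add: gark_scheme_def)

lemma A_mult_carrier [simp]:
  "q \<in> P \<Longrightarrow> m \<in> P \<Longrightarrow> v \<in> carrier_vec (stages G m) \<Longrightarrow>
    Acoeff G q m *\<^sub>v v \<in> carrier_vec (stages G q)"
  by (rule mult_mat_vec_carrier) simp_all

lemma c_carrier [simp]: "q \<in> P \<Longrightarrow> m \<in> P \<Longrightarrow> ccoeff G q m \<in> carrier_vec (stages G q)"
  by (simp add: ccoeff_def)

text \<open>A diagonal factor on the right scales columns and one on the left scales rows, so the
  matrix identity can be read entry by entry.\<close>

lemma symplectic_entry:
  assumes "m \<in> P" "l \<in> P" and i: "i < stages G m" and j: "j < stages G l"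
  shows "bcoeff G m $ i * Acoeff G m l $$ (i, j) + bcoeff G l $ j * Acoeff G l m $$ (j, i)
         = bcoeff G m $ i * bcoeff G l $ j"
proof -
  note c = A_carrier[OF assms(1,2)] A_carrier[OF assms(2,1)] b_carrier[OF assms(1)] b_carrier[OF assms(2)]
  have "(transpose_mat (Acoeff G l m) * Bdiag G l + Bdiag G m * Acoeff G m l) $$ (i, j)
      = outer (bcoeff G m) (bcoeff G l) $$ (i, j)"
    using symplectic assms(1,2) by (simp add: symplectic_def)
  moreover have "transpose_mat (Acoeff G l m) * Bdiag G l
      = mat (stages G m) (stages G l) (\<lambda>(i, j). bcoeff G l $ j * Acoeff G l m $$ (j, i))"
    using c unfolding Bdiag_def
    by (subst mat_diag_mult_right[where n = "stages G l" and A = "transpose_mat (Acoeff G l m)" and nr = "stages G m"]) auto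
  moreover have "Bdiag G m * Acoeff G m l
      = mat (stages G m) (stages G l) (\<lambda>(i, j). bcoeff G m $ i * Acoeff G m l $$ (i, j))"
    using c unfolding Bdiag_def
    by (subst mat_diag_mult_left[where n = "stages G m" and nr = "stages G l"]) auto
  moreover have "outer (bcoeff G m) (bcoeff G l) $$ (i, j) = bcoeff G m $ i * bcoeff G l $ j"
    using c i j by (simp add: outer_def)
  ultimately show ?thesis
    using i j by simp
qed

text \<open>Separates the weights b_i a_ij from u_i v_j, the form to which
  \<open>symplectic_entry\<close> applies.\<close>

lemma pairing_sum:
  assumes "m \<in> P" "l \<in> P" and u: "u \<in> carrier_vec (stages G m)" and v: "v \<in> carrier_vec (stages G l)"
  shows "bcoeff G m \<bullet> (u \<odot> (Acoeff G m l *\<^sub>v v))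
    = (\<Sum>i<stages G m. \<Sum>j<stages G l. (bcoeff G m $ i * Acoeff G m l $$ (i, j)) * (u $ i * v $ j))"
  using A_carrier[OF assms(1,2)] b_carrier[OF assms(1)] u v
  by (auto simp: scalar_prod_def cprod_def sum_distrib_left atLeast0LessThan algebra_simps
      intro!: sum.cong)

text \<open>Multiply \<open>symplectic_entry\<close> by u_i v_j and sum over i and j; the right-hand
  side then factors.\<close>

lemma symplectic_pairing:
  assumes "m \<in> P" "l \<in> P" and u: "u \<in> carrier_vec (stages G m)" and v: "v \<in> carrier_vec (stages G l)"
  shows "bcoeff G m \<bullet> (u \<odot> (Acoeff G m l *\<^sub>v v)) + bcoeff G l \<bullet> (v \<odot> (Acoeff G l m *\<^sub>v u))
    = (bcoeff G m \<bullet> u) * (bcoeff G l \<bullet> v)"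
proof -
  let ?a = "\<lambda>i j. bcoeff G m $ i * Acoeff G m l $$ (i, j)"
  let ?a' = "\<lambda>i j. bcoeff G l $ j * Acoeff G l m $$ (j, i)"
  let ?M = "{..<stages G m}" and ?L = "{..<stages G l}"
  have "bcoeff G l \<bullet> (v \<odot> (Acoeff G l m *\<^sub>v u)) = (\<Sum>i\<in>?M. \<Sum>j\<in>?L. ?a' i j * (u $ i * v $ j))"
    \<comment> \<open>The roles of \<open>m\<close> and \<open>l\<close> are exchanged here;
      \<open>sum.swap\<close> restores the order of summation so that the two double sums can be
      merged.\<close>
    unfolding pairing_sum[OF assms(2,1) v u] by (subst sum.swap) (simp add: mult_ac)
  then have "bcoeff G m \<bullet> (u \<odot> (Acoeff G m l *\<^sub>v v)) + bcoeff G l \<bullet> (v \<odot> (Acoeff G l m *\<^sub>v u))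
      = (\<Sum>i\<in>?M. \<Sum>j\<in>?L. (?a i j + ?a' i j) * (u $ i * v $ j))"
    unfolding pairing_sum[OF assms] by (simp add: sum.distrib distrib_right)
  also have "\<dots> = (\<Sum>i\<in>?M. \<Sum>j\<in>?L. (bcoeff G m $ i * u $ i) * (bcoeff G l $ j * v $ j))"
    using assms(1,2) by (intro sum.cong refl) (simp add: symplectic_entry)
  also have "\<dots> = (bcoeff G m \<bullet> u) * (bcoeff G l \<bullet> v)"
    using u v by (simp add: scalar_prod_def sum_product atLeast0LessThan)
  finally show ?thesis .
qed

text \<open>The case where \<open>u\<close> is the vector of ones: \<open>A_lm\<close> applied to it
  is \<open>c_lm\<close>, and order 1 turns the factor \<open>b_m . u\<close> into 1.\<close>

lemma pairing_ones:
  assumes "m \<in> P" "l \<in> P" and v: "v \<in> carrier_vec (stages G l)"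
    and "satisfies G (Cond1 m)"
  shows "bcoeff G m \<bullet> (Acoeff G m l *\<^sub>v v) + bcoeff G l \<bullet> (v \<odot> ccoeff G l m) = bcoeff G l \<bullet> v"
  using symplectic_pairing[OF assms(1,2) ones_carrier v] assms
  by (simp add: ccoeff_def[symmetric])

section \<open>Exchange relations between order conditions\<close>

text \<open>With \<open>v\<close> the vector of ones, the left-hand sides of the two conditions add
  up to 1, so one is 1/2 exactly if the other is.\<close>

lemma cond2_flip:
  assumes "m \<in> P" "l \<in> P" "satisfies G (Cond1 m)" "satisfies G (Cond1 l)"
  shows "satisfies G (Cond2 m l) \<longleftrightarrow> satisfies G (Cond2 l m)"
  using pairing_ones[OF assms(1,2) ones_carrier assms(3)] assms
  by (auto simp: ccoeff_def[symmetric])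

text \<open>For \<open>l = m\<close> the two summands coincide, so each is 1/2.\<close>

lemma cond2_diag:
  assumes "m \<in> P" "satisfies G (Cond1 m)"
  shows "satisfies G (Cond2 m m)"
  using pairing_ones[OF assms(1,1) ones_carrier assms(2)] assms
  by (simp add: ccoeff_def[symmetric])

lemma cond3a_commute:
  "m \<in> P \<Longrightarrow> l \<in> P \<Longrightarrow> s \<in> P \<Longrightarrow> satisfies G (Cond3a m l s) \<longleftrightarrow> satisfies G (Cond3a m s l)"
  by (simp add: cprod_commute[of _ "stages G m"])

text \<open>With v = \<open>c_ls\<close> the two left-hand sides add up to 1/2 = 1/6 + 1/3.\<close>

lemma cond3b_iff_cond3a:
  assumes "m \<in> P" "l \<in> P" "s \<in> P" "satisfies G (Cond1 m)" "satisfies G (Cond2 l s)"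
  shows "satisfies G (Cond3b m l s) \<longleftrightarrow> satisfies G (Cond3a l s m)"
  using pairing_ones[OF assms(1,2) _ assms(4), of "ccoeff G l s"] assms by auto

text \<open>These adjacent transpositions generate all permutations of the last three
  indices.\<close>

lemma cond4a_swap:
  assumes "m \<in> P" "l \<in> P" "s \<in> P" "t \<in> P"
  shows "satisfies G (Cond4a m l s t) \<longleftrightarrow> satisfies G (Cond4a m s l t)"
    and "satisfies G (Cond4a m l s t) \<longleftrightarrow> satisfies G (Cond4a m l t s)"
  using assms
  by (simp_all add: cprod_assoc[of _ "stages G m"] cprod_commute[of _ "stages G m"]
      cprod_left_commute[of _ "stages G m"])

text \<open>The two left-hand sides add up to the (3a) value: 1/3 = 1/12 + 1/4.\<close>

lemma cond4c_iff_cond4a: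
  assumes "m \<in> P" "l \<in> P" "s \<in> P" "t \<in> P" "satisfies G (Cond1 m)" "satisfies G (Cond3a l s t)"
  shows "satisfies G (Cond4c m l s t) \<longleftrightarrow> satisfies G (Cond4a l s t m)"
  using pairing_ones[OF assms(1,2) _ assms(5), of "ccoeff G l s \<odot> ccoeff G l t"] assms by auto

text \<open>The two left-hand sides add up to the (3b) value: 1/6 = 1/24 + 1/8.\<close>

lemma cond4d_iff_cond4b:
  assumes "m \<in> P" "l \<in> P" "s \<in> P" "t \<in> P" "satisfies G (Cond1 m)" "satisfies G (Cond3b l s t)"
  shows "satisfies G (Cond4d m l s t) \<longleftrightarrow> satisfies G (Cond4b l m s t)"
  using pairing_ones[OF assms(1,2) _ assms(5), of "Acoeff G l s *\<^sub>v ccoeff G s t"] assms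
  by (auto simp: cprod_commute[of "ccoeff G l m" "stages G l"])

text \<open>The pairing across the edge between \<open>m\<close> and \<open>s\<close>, with u =
  \<open>c_ml\<close> and v = \<open>c_st\<close>: order 2 makes the product 1/4 = 1/8 +
  1/8.\<close>

lemma cond4b_flip:
  assumes "m \<in> P" "l \<in> P" "s \<in> P" "t \<in> P" "satisfies G (Cond2 m l)" "satisfies G (Cond2 s t)"
  shows "satisfies G (Cond4b m l s t) \<longleftrightarrow> satisfies G (Cond4b s t m l)"
proof -
  have order2: "bcoeff G m \<bullet> ccoeff G m l = 1 / 2" "bcoeff G s \<bullet> ccoeff G s t = 1 / 2"
    using assms by simp_all
  then show ?thesis
    using symplectic_pairing[OF assms(1,3) c_carrier[OF assms(1,2)] c_carrier[OF assms(3,4)]]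
    unfolding order2 by auto
qed

text \<open>At a fixed point of the involution the two summands agree, so each is half of
  1/4.\<close>

lemma cond4b_diag:
  assumes "m \<in> P" "l \<in> P" "satisfies G (Cond2 m l)"
  shows "satisfies G (Cond4b m l m l)"
proof -
  have order2: "bcoeff G m \<bullet> ccoeff G m l = 1 / 2"
    using assms by simp
  then show ?thesis
    using symplectic_pairing[OF assms(1,1) c_carrier[OF assms(1,2)] c_carrier[OF assms(1,2)]]
    unfolding order2 by auto
qed

end

section \<open>The selections and their cardinalities\<close>

declare satisfies.simps [simp del]

text \<open>The larger index comes first, so that it bounds the range of the other one and the
  cardinality is a plain sum. \<open>sel3\<close> restores the increasing order.\<close>

definition tri :: "nat \<Rightarrow> (nat \<times> nat) set" where
  "tri N = (SIGMA s:{1..N}. {1..s})"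

definition tri_strict :: "nat \<Rightarrow> (nat \<times> nat) set" where
  "tri_strict N = (SIGMA s:{1..N}. {1..<s})"

text \<open>Multisets of three indices, stored in decreasing order; their number is the tetrahedral
  number.\<close>

definition tetra :: "nat \<Rightarrow> (nat \<times> nat \<times> nat) set" where
  "tetra N = (SIGMA t:{1..N}. tri t)"

lemma finite_tri [simp]: "finite (tri N)"
  by (simp add: tri_def)

lemma finite_tri_strict [simp]: "finite (tri_strict N)"
  by (simp add: tri_strict_def)

lemma finite_tetra [simp]: "finite (tetra N)"
  by (simp add: tetra_def)

lemma card_tri: "real (card (tri N)) = real N * (real N + 1) / 2"
proof -
  have "real (\<Sum>s\<in>{1..N}. s) = real N * (real N + 1) / 2"
    by (induction N) (simp_all add: field_simps)
  then show ?thesis by (simp add: tri_def)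
qed

lemma card_tri_strict: "real (card (tri_strict N)) = real N * (real N - 1) / 2"
proof -
  \<comment> \<open>On the left \<open>s - 1\<close> is subtraction of naturals, exact because
    \<open>s\<close> is at least 1; on the right it is real, and the product vanishes for
    \<open>N = 0\<close>.\<close>
  have "real (\<Sum>s\<in>{1..N}. s - 1) = real N * (real N - 1) / 2"
    by (induction N) (simp_all add: field_simps)
  then show ?thesis by (simp add: tri_strict_def)
qed

lemma card_tetra: "real (card (tetra N)) = real N * (real N + 1) * (real N + 2) / 6"
proof -
  have "(\<Sum>t\<in>{1..N}. real (card (tri t))) = real N * (real N + 1) * (real N + 2) / 6"
    by (induction N) (simp_all add: card_tri field_simps)
  then show ?thesis by (simp add: tetra_def)
qed

text \<open>One condition for each unordered pair of distinct partitions.\<close>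

definition sel2 :: "nat \<Rightarrow> order_cond set" where
  "sel2 N = (\<lambda>(m, l). Cond2 m l) ` tri_strict N"

definition sel3 :: "nat \<Rightarrow> order_cond set" where
  "sel3 N = (\<lambda>(m, s, l). Cond3a m l s) ` ({1..N} \<times> tri N)"

definition sel4a :: "nat \<Rightarrow> order_cond set" where
  "sel4a N = (\<lambda>(m, t, s, l). Cond4a m l s t) ` ({1..N} \<times> tetra N)"

text \<open>
  The involution \<open>(m, l, s, t) \<mapsto> (s, t, m, l)\<close> swaps two index pairs; the representatives are
  the tuples with \<open>(m, l)\<close> lexicographically above \<open>(s, t)\<close>.
\<close>

definition sel4b :: "nat \<Rightarrow> order_cond set" where
  "sel4b N = (\<lambda>((m, s), l, t). Cond4b m l s t) ` (tri_strict N \<times> {1..N} \<times> {1..N})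
     \<union> (\<lambda>(m, l, t). Cond4b m l m t) ` ({1..N} \<times> tri_strict N)"

lemma sel2_subset: "sel2 N \<subseteq> order2_conds N"
  by (auto simp: sel2_def order2_conds_def tri_strict_def)

lemma sel3_subset: "sel3 N \<subseteq> order3_conds N"
  by (auto simp: sel3_def order3_conds_def tri_def)

lemma sel4_subset: "sel4a N \<union> sel4b N \<subseteq> order4_conds N"
  by (auto simp: sel4a_def sel4b_def order4_conds_def tri_def tri_strict_def tetra_def)

lemma finite_sel [simp]: "finite (sel3 N)" "finite (sel4a N)" "finite (sel4b N)"
  by (simp_all add: sel3_def sel4a_def sel4b_def)

lemma card_sel2: "real (card (sel2 N)) = real N * (real N - 1) / 2"
proof -
  have "card (sel2 N) = card (tri_strict N)"
    unfolding sel2_def by (rule card_image) (auto simp: inj_on_def)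
  then show ?thesis by (simp add: card_tri_strict)
qed

lemma card_sel3: "real (card (sel3 N)) = (real N ^ 3 + real N ^ 2) / 2"
proof -
  have "card (sel3 N) = card ({1..N} \<times> tri N)"
    unfolding sel3_def by (rule card_image) (auto simp: inj_on_def)
  then show ?thesis
    by (simp add: card_cartesian_product card_tri field_simps power2_eq_square power3_eq_cube)
qed

lemma card_sel4a: "real (card (sel4a N)) = real N ^ 2 * (real N + 1) * (real N + 2) / 6"
proof -
  have "card (sel4a N) = card ({1..N} \<times> tetra N)"
    unfolding sel4a_def by (rule card_image) (auto simp: inj_on_def)
  then show ?thesis
    by (simp add: card_cartesian_product card_tetra field_simps power2_eq_square)
qed

text \<open>This is the number of 2-cycles: of the N^4 tuples, the N^2 of the form (m, l, m, l) are
  fixed. The proof counts representatives by whether \<open>s < m\<close> or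
  \<open>s = m\<close>.\<close>

lemma card_sel4b: "real (card (sel4b N)) = real N ^ 2 * (real N ^ 2 - 1) / 2"
proof -
  let ?U = "(\<lambda>((m, s), l, t). Cond4b m l s t) ` (tri_strict N \<times> {1..N} \<times> {1..N})"
  let ?V = "(\<lambda>(m, l, t). Cond4b m l m t) ` ({1..N} \<times> tri_strict N)"
  have "card ?U = card (tri_strict N \<times> {1..N} \<times> {1..N})"
    by (rule card_image) (auto simp: inj_on_def)
  moreover have "card ?V = card ({1..N} \<times> tri_strict N)"
    by (rule card_image) (auto simp: inj_on_def)
  \<comment> \<open>The first and third indices differ throughout \<open>?U\<close> and agree
    throughout \<open>?V\<close>.\<close>
  moreover have "card (sel4b N) = card ?U + card ?V"
    unfolding sel4b_def by (rule card_Un_disjoint) (auto simp: tri_strict_def)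
  ultimately have "real (card (sel4b N)) = real (card (tri_strict N)) * real N ^ 2
      + real N * real (card (tri_strict N))"
    by (simp add: card_cartesian_product power2_eq_square)
  then show ?thesis
    by (simp add: card_tri_strict field_simps power2_eq_square)
qed

lemma card_sel4: "real (card (sel4a N \<union> sel4b N)) = (4 * real N ^ 4 + 3 * real N ^ 3 - real N ^ 2) / 6"
proof -
  have "card (sel4a N \<union> sel4b N) = card (sel4a N) + card (sel4b N)"
    by (rule card_Un_disjoint) (auto simp: sel4a_def sel4b_def)
  then show ?thesis
    by (simp add: card_sel4a card_sel4b field_simps eval_nat_numeral)
qed

section \<open>Counting all order conditions\<close>

lemma order2_conds_image: "order2_conds N = (\<lambda>(m, l). Cond2 m l) ` ({1..N} \<times> {1..N})"
  by (auto simp: order2_conds_def)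

lemma finite_order2: "finite (order2_conds N)"
  by (simp add: order2_conds_image)

lemma card_order2: "real (card (order2_conds N)) = real N ^ 2"
proof -
  have "card (order2_conds N) = card ({1..N} \<times> {1..N})"
    unfolding order2_conds_image by (rule card_image) (auto simp: inj_on_def)
  then show ?thesis by (simp add: card_cartesian_product power2_eq_square)
qed

definition conds3b :: "nat \<Rightarrow> order_cond set" where
  "conds3b N = (\<lambda>(m, l, s). Cond3b m l s) ` ({1..N} \<times> {1..N} \<times> {1..N})"

text \<open>\<open>sel3\<close> is already the whole family (3a), so its count can be
  reused.\<close>

lemma order3_conds_eq: "order3_conds N = sel3 N \<union> conds3b N"
  by (auto simp: order3_conds_def sel3_def conds3b_def tri_def image_iff)

lemma finite_order3: "finite (order3_conds N)"
  by (simp add: order3_conds_eq conds3b_def)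

lemma card_order3: "real (card (order3_conds N)) = (3 * real N ^ 3 + real N ^ 2) / 2"
proof -
  have "card (conds3b N) = card ({1..N} \<times> {1..N} \<times> {1..N})"
    unfolding conds3b_def by (rule card_image) (auto simp: inj_on_def)
  moreover have "card (order3_conds N) = card (sel3 N) + card (conds3b N)"
    unfolding order3_conds_eq by (rule card_Un_disjoint) (auto simp: sel3_def conds3b_def)
  ultimately show ?thesis
    by (simp add: card_cartesian_product card_sel3 field_simps power3_eq_cube)
qed

definition conds4b :: "nat \<Rightarrow> order_cond set" where
  "conds4b N = (\<lambda>(m, l, s, t). Cond4b m l s t) ` ({1..N} \<times> {1..N} \<times> {1..N} \<times> {1..N})"

definition conds4c :: "nat \<Rightarrow> order_cond set" where
  "conds4c N = (\<lambda>(m, l, t, s). Cond4c m l s t) ` ({1..N} \<times> {1..N} \<times> tri N)"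

definition conds4d :: "nat \<Rightarrow> order_cond set" where
  "conds4d N = (\<lambda>(m, l, s, t). Cond4d m l s t) ` ({1..N} \<times> {1..N} \<times> {1..N} \<times> {1..N})"

text \<open>\<open>sel4a\<close> is the whole family (4a); the other three families are written as
  images of products under injective maps, ready for counting.\<close>

lemma order4_conds_eq: "order4_conds N = sel4a N \<union> (conds4b N \<union> (conds4c N \<union> conds4d N))"
proof -
  have "sel4a N = {Cond4a m l s t | m l s t.
      m \<in> {1..N} \<and> l \<in> {1..N} \<and> s \<in> {1..N} \<and> t \<in> {1..N} \<and> l \<le> s \<and> s \<le> t}"
    by (auto simp: sel4a_def tri_def tetra_def image_iff)
  moreover have "conds4b N = {Cond4b m l s t | m l s t.
      m \<in> {1..N} \<and> l \<in> {1..N} \<and> s \<in> {1..N} \<and> t \<in> {1..N}}"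
    by (auto simp: conds4b_def image_iff)
  moreover have "conds4c N = {Cond4c m l s t | m l s t.
      m \<in> {1..N} \<and> l \<in> {1..N} \<and> s \<in> {1..N} \<and> t \<in> {1..N} \<and> s \<le> t}"
    by (auto simp: conds4c_def tri_def image_iff)
  moreover have "conds4d N = {Cond4d m l s t | m l s t.
      m \<in> {1..N} \<and> l \<in> {1..N} \<and> s \<in> {1..N} \<and> t \<in> {1..N}}"
    by (auto simp: conds4d_def image_iff)
  ultimately show ?thesis
    unfolding order4_conds_def by (simp only: Un_assoc)
qed

lemma finite_conds4: "finite (conds4b N)" "finite (conds4c N)" "finite (conds4d N)"
  by (simp_all add: conds4b_def conds4c_def conds4d_def)

lemma finite_order4: "finite (order4_conds N)"
  by (simp add: order4_conds_eq finite_conds4)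

lemma card_order4:
  "real (card (order4_conds N)) = (8 * real N ^ 4 + 3 * real N ^ 3 + real N ^ 2) / 3"
proof -
  have "card (conds4b N) = card ({1..N} \<times> {1..N} \<times> {1..N} \<times> {1..N})"
    unfolding conds4b_def by (rule card_image) (auto simp: inj_on_def)
  moreover have "card (conds4c N) = card ({1..N} \<times> {1..N} \<times> tri N)"
    unfolding conds4c_def by (rule card_image) (auto simp: inj_on_def)
  moreover have "card (conds4d N) = card ({1..N} \<times> {1..N} \<times> {1..N} \<times> {1..N})"
    unfolding conds4d_def by (rule card_image) (auto simp: inj_on_def)
  \<comment> \<open>Distinct constructors keep the four families disjoint.\<close>
  moreover have "sel4a N \<inter> (conds4b N \<union> (conds4c N \<union> conds4d N)) = {}"
    "conds4b N \<inter> (conds4c N \<union> conds4d N) = {}" "conds4c N \<inter> conds4d N = {}"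
    by (auto simp: sel4a_def conds4b_def conds4c_def conds4d_def)
  then have "card (order4_conds N)
      = card (sel4a N) + (card (conds4b N) + (card (conds4c N) + card (conds4d N)))"
    by (simp add: order4_conds_eq card_Un_disjoint finite_conds4)
  ultimately show ?thesis
    by (simp add: card_cartesian_product card_sel4a card_tri field_simps eval_nat_numeral)
qed

section \<open>Sufficiency of the selections\<close>

context symplectic_gark
begin

lemma sel2_sufficient:
  assumes "order_at_least_1 N G" "satisfies_all G (sel2 N)"
  shows "satisfies_all G (order2_conds N)"
proof -
  have c1: "satisfies G (Cond1 m)" if "m \<in> P" for m
    using assms(1) that unfolding order_at_least_1_def satisfies_all_def order1_conds_def by blast
  have sel: "satisfies G (Cond2 m l)" if "m \<in> P" "l \<in> P" "l < m" for m l
    using assms(2) that unfolding satisfies_all_def sel2_def tri_strict_def by force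
  \<comment> \<open>Trichotomy: selected if \<open>l < m\<close>, automatic if \<open>l = m\<close>,
    flipped from a selected condition if \<open>m < l\<close>.\<close>
  have "satisfies G (Cond2 m l)" if "m \<in> P" "l \<in> P" for m l
    using that sel cond2_diag cond2_flip c1 by (metis linorder_cases)
  then show ?thesis
    unfolding satisfies_all_def order2_conds_def by blast
qed

lemma order_at_least_2D:
  assumes "order_at_least_2 N G"
  shows "m \<in> P \<Longrightarrow> satisfies G (Cond1 m)"
    and "m \<in> P \<Longrightarrow> l \<in> P \<Longrightarrow> satisfies G (Cond2 m l)"
  using assms
  unfolding order_at_least_2_def order_at_least_1_def satisfies_all_def order1_conds_def order2_conds_def
  by blast+

lemma cond3a_of_sel3:
  assumes "satisfies_all G (sel3 N)" "m \<in> P" "l \<in> P" "s \<in> P"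
  shows "satisfies G (Cond3a m l s)"
proof -
  have "satisfies G (Cond3a m l s)" if "l \<in> P" "s \<in> P" "l \<le> s" for l s
    using assms(1,2) that unfolding satisfies_all_def sel3_def tri_def by force
  then show ?thesis
    using assms(2-) cond3a_commute by (metis linorder_le_cases)
qed

text \<open>Condition (3b) at (m, l, s) needs (3a) at (l, s, m), whose last two indices may be
  unsorted; hence the passage through \<open>cond3a_of_sel3\<close>.\<close>

lemma sel3_sufficient:
  assumes "order_at_least_2 N G" "satisfies_all G (sel3 N)"
  shows "satisfies_all G (order3_conds N)"
proof -
  have "satisfies G (Cond3b m l s)" if "m \<in> P" "l \<in> P" "s \<in> P" for m l s
    using that by (simp add: cond3b_iff_cond3a cond3a_of_sel3[OF assms(2)] order_at_least_2D[OF assms(1)])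
  then show ?thesis
    using assms(2) by (auto simp: satisfies_all_def order3_conds_eq conds3b_def)
qed

lemma cond4a_of_sel4a:
  assumes "satisfies_all G (sel4a N)" "m \<in> P" "l \<in> P" "s \<in> P" "t \<in> P"
  shows "satisfies G (Cond4a m l s t)"
proof -
  have sorted: "satisfies G (Cond4a m l s t)" if "l \<in> P" "s \<in> P" "t \<in> P" "l \<le> s" "s \<le> t" for l s t
    using assms(1,2) that unfolding satisfies_all_def sel4a_def tri_def tetra_def by force
  \<comment> \<open>Insertion of \<open>t\<close> into the sorted pair takes at most two adjacent
    swaps; the final step allows one more to sort \<open>l\<close> and \<open>s\<close>.\<close>
  have "satisfies G (Cond4a m l s t)" if "l \<in> P" "s \<in> P" "t \<in> P" "l \<le> s" for l s t
    using that sorted cond4a_swap[OF assms(2)] by (metis linorder_le_cases)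
  then show ?thesis
    using assms(3-) cond4a_swap[OF assms(2)] by (metis linorder_le_cases)
qed

lemma cond4b_of_sel4b:
  assumes "order_at_least_2 N G" "satisfies_all G (sel4b N)" "m \<in> P" "l \<in> P" "s \<in> P" "t \<in> P"
  shows "satisfies G (Cond4b m l s t)"
proof -
  have lt: "satisfies G (Cond4b m l s t)"
    if "m \<in> P" "l \<in> P" "s \<in> P" "t \<in> P" "s < m \<or> s = m \<and> t < l" for m l s t
  proof -
    have "Cond4b m l s t \<in> sel4b N"
      using that(5)
    proof
      assume "s < m"
      then show ?thesis
        using that unfolding sel4b_def
        by (intro UnI1 image_eqI[of _ _ "((m, s), l, t)"]) (auto simp: tri_strict_def)
    next
      assume "s = m \<and> t < l"
      then show ?thesis
        using that unfolding sel4b_def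
        by (intro UnI2 image_eqI[of _ _ "(m, l, t)"]) (auto simp: tri_strict_def)
    qed
    then show ?thesis
      using assms(2) by (simp add: satisfies_all_def)
  qed
  \<comment> \<open>Lexicographic comparison of (m, l) with (s, t): a representative, the image of
    one under the involution, or a fixed point.\<close>
  consider "s < m \<or> s = m \<and> t < l" | "m < s \<or> m = s \<and> l < t" | "m = s \<and> l = t"
    by linarith
  then show ?thesis
  proof cases
    case 1
    then show ?thesis using lt assms(3-) by blast
  next
    case 2
    then have "satisfies G (Cond4b s t m l)" using lt assms(3-) by blast
    then show ?thesis
      using assms(3-) by (simp add: cond4b_flip[of m l s t] order_at_least_2D[OF assms(1)])
  next
    case 3
    then show ?thesis
      using assms(3-) by (simp add: cond4b_diag order_at_least_2D[OF assms(1)])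
  qed
qed

text \<open>Order 3 supplies the values on the right of the exchange relations: (3a) turns (4a) into
  (4c), and (3b) turns (4b) into (4d).\<close>

lemma sel4_sufficient:
  assumes "order_at_least_3 N G" "satisfies_all G (sel4a N \<union> sel4b N)"
  shows "satisfies_all G (order4_conds N)"
proof -
  have o2: "order_at_least_2 N G" and c3: "satisfies_all G (order3_conds N)"
    using assms(1) by (simp_all add: order_at_least_3_def)
  have sel: "satisfies_all G (sel4a N)" "satisfies_all G (sel4b N)"
    using assms(2) by (auto simp: satisfies_all_def)
  \<comment> \<open>The order-3 conditions list (3a) for sorted tuples only; symmetry extends it to
    all tuples.\<close>
  have c3a: "satisfies G (Cond3a m l s)" if "m \<in> P" "l \<in> P" "s \<in> P" for m l s
    using c3 that cond3a_of_sel3 by (simp add: satisfies_all_def order3_conds_eq)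
  have c3b: "satisfies G (Cond3b m l s)" if "m \<in> P" "l \<in> P" "s \<in> P" for m l s
    using c3 that unfolding satisfies_all_def order3_conds_def by blast
  have "satisfies G (Cond4c m l s t)" if "m \<in> P" "l \<in> P" "s \<in> P" "t \<in> P" for m l s t
    using that by (simp add: cond4c_iff_cond4a cond4a_of_sel4a[OF sel(1)] order_at_least_2D[OF o2] c3a)
  moreover have "satisfies G (Cond4d m l s t)" if "m \<in> P" "l \<in> P" "s \<in> P" "t \<in> P" for m l s t
    using that by (simp add: cond4d_iff_cond4b cond4b_of_sel4b[OF o2 sel(2)] order_at_least_2D[OF o2] c3b)
  moreover have "satisfies G (Cond4a m l s t)" if "m \<in> P" "l \<in> P" "s \<in> P" "t \<in> P" for m l s t
    using that by (rule cond4a_of_sel4a[OF sel(1)])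
  moreover have "satisfies G (Cond4b m l s t)" if "m \<in> P" "l \<in> P" "s \<in> P" "t \<in> P" for m l s t
    using that by (rule cond4b_of_sel4b[OF o2 sel(2)])
  ultimately show ?thesis
    by (auto simp: satisfies_all_def order4_conds_def)
qed

end

theorem theorem3p3:
  fixes N :: nat
  assumes "N \<ge> 1"
  shows
    "(finite (order2_conds N) \<and> real (card (order2_conds N)) = real N ^ 2 \<and>
      (\<exists>S. S \<subseteq> order2_conds N \<and>
           real (card S) = real N * (real N - 1) / 2 \<and>
           (\<forall>G :: gark. gark_scheme N G \<and> symplectic N G \<and> order_at_least_1 N G \<and> satisfies_all G S
                 \<longrightarrow> satisfies_all G (order2_conds N)))) \<and>
     (finite (order3_conds N) \<and> real (card (order3_conds N)) = (3 * real N ^ 3 + real N ^ 2) / 2 \<and>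
      (\<exists>S. S \<subseteq> order3_conds N \<and>
           real (card S) = (real N ^ 3 + real N ^ 2) / 2 \<and>
           (\<forall>G :: gark. gark_scheme N G \<and> symplectic N G \<and> order_at_least_2 N G \<and> satisfies_all G S
                 \<longrightarrow> satisfies_all G (order3_conds N)))) \<and>
     (finite (order4_conds N) \<and>
      real (card (order4_conds N)) = (8 * real N ^ 4 + 3 * real N ^ 3 + real N ^ 2) / 3 \<and>
      (\<exists>S. S \<subseteq> order4_conds N \<and>
           real (card S) = (4 * real N ^ 4 + 3 * real N ^ 3 - real N ^ 2) / 6 \<and>
           (\<forall>G :: gark. gark_scheme N G \<and> symplectic N G \<and> order_at_least_3 N G \<and> satisfies_all G S
                 \<longrightarrow> satisfies_all G (order4_conds N))))"
proof (intro conjI)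
  show "\<exists>S. S \<subseteq> order2_conds N \<and>
           real (card S) = real N * (real N - 1) / 2 \<and>
           (\<forall>G :: gark. gark_scheme N G \<and> symplectic N G \<and> order_at_least_1 N G \<and> satisfies_all G S
                 \<longrightarrow> satisfies_all G (order2_conds N))"
    using sel2_subset card_sel2 symplectic_gark.sel2_sufficient
    by (intro exI[of _ "sel2 N"]) (auto simp: symplectic_gark_def)
  show "\<exists>S. S \<subseteq> order3_conds N \<and>
           real (card S) = (real N ^ 3 + real N ^ 2) / 2 \<and>
           (\<forall>G :: gark. gark_scheme N G \<and> symplectic N G \<and> order_at_least_2 N G \<and> satisfies_all G S
                 \<longrightarrow> satisfies_all G (order3_conds N))"
    using sel3_subset card_sel3 symplectic_gark.sel3_sufficient
    by (intro exI[of _ "sel3 N"]) (auto simp: symplectic_gark_def)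
  show "\<exists>S. S \<subseteq> order4_conds N \<and>
           real (card S) = (4 * real N ^ 4 + 3 * real N ^ 3 - real N ^ 2) / 6 \<and>
           (\<forall>G :: gark. gark_scheme N G \<and> symplectic N G \<and> order_at_least_3 N G \<and> satisfies_all G S
                 \<longrightarrow> satisfies_all G (order4_conds N))"
    using sel4_subset card_sel4 symplectic_gark.sel4_sufficient
    by (intro exI[of _ "sel4a N \<union> sel4b N"]) (auto simp: symplectic_gark_def)
qed (rule finite_order2 card_order2 finite_order3 card_order3 finite_order4 card_order4)+

end
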